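(* Let $ABC$ be a triangle in the Euclidean plane with circumcenter $O$ and Lemoine point $L$. Let $\Omega_1,\Omega_2$ be its first and second Brocard points, and let $L_1,L_2,L_3$ be the points whose pedal triangles $A_1B_1C_1$ are positively oriented and satisfy $\triangle A_1B_1C_1\sim\triangle ACB$ (for $L_1$), $\triangle A_1B_1C_1\sim\triangle CBA$ (for $L_2$), $\triangle A_1B_1C_1\sim\triangle BAC$ (for $L_3$). Then the six points $O,\Omega_1,\Omega_2,L_1,L_2,L_3$, whose pedal triangles are positively oriented and similar to $\triangle ABC$, lie on the Brocard circle of $\triangle ABC$, i.e. the circle with diameter $OL$.
   Context: $ABC$ is a (nondegenerate) triangle with circumcircle $k(O,R)$, $BC=a$, $CA=b$, $AB=c$. For a point $M$ of the plane not on $k$, its pedal triangle is $A_1B_1C_1$, where $A_1,B_1,C_1$ are the orthogonal projections of $M$ on the lines $BC,CA,AB$, respectively. It is called positively oriented if the ordered triple $A_1,B_1,C_1$ has the same orientation as $A,B,C$, and negatively oriented otherwise. Similarities of triangles respect the order of the vertices (e.g. $\triangle A_1B_1C_1\sim\triangle BAC$ means that the angles at $A_1,B_1,C_1$ equal $\angle B,\angle A,\angle C$, respectively). For each prescribed triple of angles of a triangle there is exactly one point whose pedal triangle is positively oriented and has these angles at $A_1,B_1,C_1$; this makes $L_1,L_2,L_3$ well defined. The first Brocard point $\Omega_1$ is the point inside $\triangle ABC$ with $\angle\Omega_1AB=\angle\Omega_1BC=\angle\Omega_1CA$; the second Brocard point $\Omega_2$ is the point inside $\triangle ABC$ with $\angle\Omega_2AC=\angle\Omega_2CB=\angle\Omega_2BA$.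 The correspondences for $O,\Omega_1,\Omega_2$ are: $\triangle A_1B_1C_1\sim\triangle ABC$ for $O$, $\triangle A_1B_1C_1\sim\triangle BCA$ for $\Omega_1$, $\triangle A_1B_1C_1\sim\triangle CAB$ for $\Omega_2$. The Lemoine point $L$ is the common point of the three symmedians of $\triangle ABC$ (barycentric coordinates $a^2:b^2:c^2$). The Brocard circle is the circle with diameter $OL$, i.e. the set of points at distance $\tfrac12 OL$ from the midpoint of $OL$ (when $ABC$ is equilateral, $O=L$ and it reduces to the point $O$). *)

theory Defs
  imports "HOL-Analysis.Analysis"
begin

text \<open>The Euclidean plane is \<^typ>\<open>real^2\<close>.\<close>

text \<open>The angle at the vertex \<open>Q\<close>, in \<open>[0, pi]\<close>; only meaningful for \<open>P \<noteq> Q\<close> and \<open>R \<noteq> Q\<close>.\<close>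

definition angle :: "real^2 \<Rightarrow> real^2 \<Rightarrow> real^2 \<Rightarrow> real" where
  "angle P Q R = arccos (((P - Q) \<bullet> (R - Q)) / (norm (P - Q) * norm (R - Q)))"

text \<open>Twice the signed area of the triangle \<open>PQR\<close>.\<close>

definition orientation :: "real^2 \<Rightarrow> real^2 \<Rightarrow> real^2 \<Rightarrow> real" where
  "orientation P Q R = det (vector [Q - P, R - P] :: real^2^2)"

text \<open>The strict inequality makes both triples nondegenerate.\<close>

definition same_orientation ::
  "real^2 \<Rightarrow> real^2 \<Rightarrow> real^2 \<Rightarrow> real^2 \<Rightarrow> real^2 \<Rightarrow> real^2 \<Rightarrow> bool" where
  "same_orientation P Q R P' Q' R' \<longleftrightarrow> orientation P Q R * orientation P' Q' R' > 0"

text \<open>Similarity of triangles, respecting the order of the vertices; only used for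
  nondegenerate triangles.\<close>

definition similar_triangles ::
  "real^2 \<Rightarrow> real^2 \<Rightarrow> real^2 \<Rightarrow> real^2 \<Rightarrow> real^2 \<Rightarrow> real^2 \<Rightarrow> bool" where
  "similar_triangles P Q R P' Q' R' \<longleftrightarrow>
     angle R P Q = angle R' P' Q' \<and>
     angle P Q R = angle P' Q' R' \<and>
     angle Q R P = angle Q' R' P'"

text \<open>Orthogonal projection of \<open>M\<close> on the line \<open>PQ\<close>, for \<open>P \<noteq> Q\<close>.\<close>

definition foot :: "real^2 \<Rightarrow> real^2 \<Rightarrow> real^2 \<Rightarrow> real^2" where
  "foot P Q M = P + (((M - P) \<bullet> (Q - P)) / ((Q - P) \<bullet> (Q - P))) *\<^sub>R (Q - P)"

lemma foot_on_line: "foot P Q M \<in> affine hull {P, Q}"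
proof -
  let ?t = "((M - P) \<bullet> (Q - P)) / ((Q - P) \<bullet> (Q - P))"
  have "foot P Q M = (1 - ?t) *\<^sub>R P + ?t *\<^sub>R Q"
    by (simp only: foot_def scaleR_diff_left scaleR_diff_right) simp
  then show ?thesis
    unfolding affine_hull_2 by (intro CollectI exI [of _ "1 - ?t"] exI [of _ ?t]) simp
qed

lemma foot_orthogonal: "orthogonal (M - foot P Q M) (Q - P)"
proof (cases "P = Q")
  case False
  have "M - foot P Q M = (M - P) - (((M - P) \<bullet> (Q - P)) / ((Q - P) \<bullet> (Q - P))) *\<^sub>R (Q - P)"
    by (simp add: foot_def)
  then show ?thesis
    using False by (simp only: orthogonal_def inner_diff_left [of "M - P"] inner_scaleR_left) simp
qed (simp add: orthogonal_def)

text \<open>The pedal triangle of \<open>M\<close> with respect to \<open>ABC\<close> has the same orientation as \<open>ABC\<close> and is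
  similar to \<open>PQR\<close>. Points \<open>M\<close> on the circumcircle need no separate exclusion: their feet are
  collinear, so that the orientation condition fails.\<close>

definition positive_pedal_similar ::
  "real^2 \<Rightarrow> real^2 \<Rightarrow> real^2 \<Rightarrow> real^2 \<Rightarrow> real^2 \<Rightarrow> real^2 \<Rightarrow> real^2 \<Rightarrow> bool" where
  "positive_pedal_similar A B C M P Q R \<longleftrightarrow>
     (let A1 = foot B C M; B1 = foot C A M; C1 = foot A B M
      in same_orientation A1 B1 C1 A B C \<and> similar_triangles A1 B1 C1 P Q R)"

definition is_circumcenter :: "real^2 \<Rightarrow> real^2 \<Rightarrow> real^2 \<Rightarrow> real^2 \<Rightarrow> bool" where
  "is_circumcenter A B C Z \<longleftrightarrow> dist Z A = dist Z B \<and> dist Z B = dist Z C"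

text \<open>The sum of the unit vectors along the two sides directs the internal bisector at \<open>A\<close>.\<close>

definition angle_bisector_point :: "real^2 \<Rightarrow> real^2 \<Rightarrow> real^2 \<Rightarrow> real^2" where
  "angle_bisector_point A B C = A + sgn (B - A) + sgn (C - A)"

definition reflect :: "real^2 \<Rightarrow> real^2 \<Rightarrow> real^2 \<Rightarrow> real^2" where
  "reflect P Q X = 2 *\<^sub>R foot P Q X - X"

text \<open>The symmedian through \<open>A\<close>: the median through \<open>A\<close> reflected in the angle bisector at \<open>A\<close>,
  both taken as full lines.\<close>

definition symmedian :: "real^2 \<Rightarrow> real^2 \<Rightarrow> real^2 \<Rightarrow> (real^2) set" where
  "symmedian A B C = reflect A (angle_bisector_point A B C) ` (affine hull {A, midpoint B C})"

definition is_lemoine_point :: "real^2 \<Rightarrow> real^2 \<Rightarrow> real^2 \<Rightarrow> real^2 \<Rightarrow> bool" where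
  "is_lemoine_point A B C L \<longleftrightarrow>
     L \<in> symmedian A B C \<and> L \<in> symmedian B C A \<and> L \<in> symmedian C A B"

definition is_first_brocard_point :: "real^2 \<Rightarrow> real^2 \<Rightarrow> real^2 \<Rightarrow> real^2 \<Rightarrow> bool" where
  "is_first_brocard_point A B C W \<longleftrightarrow>
     W \<in> interior (convex hull {A, B, C}) \<and>
     angle W A B = angle W B C \<and> angle W B C = angle W C A"

definition is_second_brocard_point :: "real^2 \<Rightarrow> real^2 \<Rightarrow> real^2 \<Rightarrow> real^2 \<Rightarrow> bool" where
  "is_second_brocard_point A B C W \<longleftrightarrow>
     W \<in> interior (convex hull {A, B, C}) \<and>
     angle W A C = angle W C B \<and> angle W C B = angle W B A"

text \<open>The circle with diameter \<open>ZL\<close>, where \<open>Z\<close> is the circumcenter and \<open>L\<close> the Lemoine point;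
  it is \<open>{Z}\<close> if \<open>Z = L\<close>.\<close>

definition brocard_circle :: "real^2 \<Rightarrow> real^2 \<Rightarrow> (real^2) set" where
  "brocard_circle Z L = sphere (midpoint Z L) (dist Z L / 2)"

end

theory Submission
  imports Defs
begin

text \<open>Write \<open>a, b, c\<close> for the sides of \<open>ABC\<close>, \<open>S = a\<^sup>2 + b\<^sup>2 + c\<^sup>2\<close>, \<open>D\<close> for the doubled signed area of \<open>ABC\<close>,
  and \<open>S\<^sub>1, D\<^sub>1\<close> for the same quantities of the pedal triangle of \<open>M\<close>. All six points are on the
  Brocard circle for one reason: a point \<open>M\<close> is on this circle if and only if
  \<open>S\<^sub>1 / D\<^sub>1 = S / D\<close>, that is (with denominators cleared) \<open>S\<^sub>1 * D = S * D\<^sub>1\<close>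
  (\<open>brocard_circle_iff_pedal\<close>). The quotient \<open>S / \<bar>D\<bar>\<close> is twice the sum of the cotangents of
  the angles (twice the cotangent of the Brocard angle), so it is a symmetric function of the
  angles: a positively oriented pedal triangle with the angles of \<open>ABC\<close>, in whatever order they
  are distributed over its vertices, puts \<open>M\<close> on the circle.
  
  The criterion results from three formulas. Let \<open>O\<close> be the circumcenter, \<open>R\<close> the circumradius and
  \<open>p = R\<^sup>2 - OM\<^sup>2\<close>. The side of the pedal triangle that faces \<open>A\<close> is \<open>MA * \<bar>D\<bar> / (b * c)\<close>, whence
  \<open>S\<^sub>1 * a\<^sup>2 * b\<^sup>2 * c\<^sup>2 = D\<^sup>2 * (a\<^sup>2 * MA\<^sup>2 + b\<^sup>2 * MB\<^sup>2 + c\<^sup>2 * MC\<^sup>2)\<close>; Euler's pedal area formula reads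
  \<open>D\<^sub>1 * a\<^sup>2 * b\<^sup>2 * c\<^sup>2 = D^3 * p\<close>; and as the Lemoine point \<open>L\<close> is the centroid of the vertices
  with weights \<open>a\<^sup>2, b\<^sup>2, c\<^sup>2\<close>, twice \<open>S\<close> times the inner product of \<open>M - O\<close> and \<open>M - L\<close> equals
  \<open>a\<^sup>2 * MA\<^sup>2 + b\<^sup>2 * MB\<^sup>2 + c\<^sup>2 * MC\<^sup>2 - S * p\<close>. By Thales, \<open>M\<close> is on the circle with diameter \<open>OL\<close>
  if and only if this inner product vanishes.
  
  It remains to see that \<open>O\<close> and the two Brocard points have the pedal triangles described. For \<open>O\<close> this is
  the medial triangle. For the first Brocard point, the equality of the three cotangents yields
  the barycentric coordinates \<open>c\<^sup>2 a\<^sup>2 : a\<^sup>2 b\<^sup>2 : b\<^sup>2 c\<^sup>2\<close>, hence the distances to the vertices, and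
  hence the sides of the pedal triangle. Exchanging the names of \<open>B\<close> and \<open>C\<close> gives the second one.\<close>

section \<open>Coordinates and orientation\<close>

lemma inner_coords: "u \<bullet> v = u$1 * v$1 + u$2 * v$2" for u v :: "real^2"
  by (simp add: inner_vec_def sum_2)

lemma dist_sq_coords: "(dist P Q)\<^sup>2 = (P$1 - Q$1)\<^sup>2 + (P$2 - Q$2)\<^sup>2" for P Q :: "real^2"
  unfolding dist_norm power2_norm_eq_inner inner_coords by (simp add: power2_eq_square)

lemma dist_sq_inner: "(dist P Q)\<^sup>2 = (P - Q) \<bullet> (P - Q)" for P Q :: "real^2"
  by (simp add: dist_norm power2_norm_eq_inner)

lemma orientation_coords:
  "orientation P Q R = (Q$1 - P$1) * (R$2 - P$2) - (R$1 - P$1) * (Q$2 - P$2)"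
  by (simp add: orientation_def det_2 algebra_simps)

lemma plane_eq_iff: "P = Q \<longleftrightarrow> P$1 = Q$1 \<and> P$2 = Q$2" for P Q :: "real^2"
  by (simp add: vec_eq_iff forall_2)

definition quarter_turn :: "real^2 \<Rightarrow> real^2" where
  "quarter_turn v = vector [- (v$2), v$1]"

lemma quarter_turn_coords [simp]: "quarter_turn v $ 1 = - (v$2)" "quarter_turn v $ 2 = v$1"
  by (simp_all add: quarter_turn_def)

lemma orientation_rotate: "orientation P Q R = orientation Q R P"
  by (simp add: orientation_coords algebra_simps)

lemma orientation_swap: "orientation P R Q = - orientation P Q R"
  by (simp add: orientation_coords algebra_simps)

text \<open>This plays the role of \<open>cos\<^sup>2 + sin\<^sup>2 = 1\<close>: the inner product and the orientation are the cosine and,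
  up to sign, the sine of the angle at \<open>Q\<close>, both multiplied by the product of the two side lengths.\<close>

lemma lagrange_identity:
  "(norm (P - Q) * norm (R - Q))\<^sup>2 = ((P - Q) \<bullet> (R - Q))\<^sup>2 + (orientation P Q R)\<^sup>2"
  unfolding power_mult_distrib power2_norm_eq_inner inner_coords orientation_coords
  by (simp add: power2_eq_square algebra_simps)

text \<open>By the Lagrange identity, orientation zero forces equality in the Cauchy-Schwarz inequality.\<close>

lemma orientation_nonzero:
  assumes "\<not> collinear {A, B, C}"
  shows "orientation A B C \<noteq> 0"
proof
  assume 0: "orientation A B C = 0"
  have "A \<noteq> B" using assms by auto
  have "((A - B) \<bullet> (C - B))\<^sup>2 = (norm (A - B) * norm (C - B))\<^sup>2"
    by (simp only: lagrange_identity 0) simp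
  then have "\<bar>(A - B) \<bullet> (C - B)\<bar> = norm (A - B) * norm (C - B)"
    by - (rule power2_eq_imp_eq, simp_all)
  then have "collinear {0, A - B, C - B}"
    by (simp add: norm_cauchy_schwarz_equal)
  then have "collinear {A, B, C}" 
    using collinear_3[of A B C] by simp
  with assms show False by simp
qed

lemma orientation_distinct:
  assumes "orientation P Q R \<noteq> 0"
  shows "P \<noteq> Q" "Q \<noteq> R" "R \<noteq> P"
  using assms by (auto simp: orientation_coords)

section \<open>Angles, cotangents and similar triangles\<close>

text \<open>Cotangents are the convenient form of the angles here: up to sign they are quotients of
  polynomials in the coordinates, and their sum over a triangle is the sum of the squared sides
  divided by four times the area.\<close>

lemma cot_angle:
  assumes "orientation P Q R \<noteq> 0"
  shows "cot (angle P Q R) = ((P - Q) \<bullet> (R - Q)) / \<bar>orientation P Q R\<bar>"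
proof -
  define n where "n = norm (P - Q) * norm (R - Q)"
  define i where "i = (P - Q) \<bullet> (R - Q)"
  have n: "n > 0" using orientation_distinct[OF assms] by (simp add: n_def)
  have L: "n\<^sup>2 = i\<^sup>2 + (orientation P Q R)\<^sup>2"
    unfolding n_def i_def by (rule lagrange_identity)
  have "\<bar>i\<bar> \<le> n" unfolding i_def n_def by (rule Cauchy_Schwarz_ineq2)
  then have bound: "- 1 \<le> i / n" "i / n \<le> 1" using n by (auto simp: field_simps abs_le_iff)
  have a: "angle P Q R = arccos (i / n)" by (simp add: angle_def n_def i_def)
  have c: "cos (angle P Q R) = i / n" using bound by (simp add: a)
  have o: "(orientation P Q R)\<^sup>2 = n\<^sup>2 - i\<^sup>2" using L by simp
  have "1 - (i / n)\<^sup>2 = (orientation P Q R / n)\<^sup>2"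
    using n unfolding power_divide o by (simp add: diff_divide_distrib)
  then have s: "sin (angle P Q R) = \<bar>orientation P Q R\<bar> / n"
    using bound n by (simp add: a sin_arccos)
  show ?thesis using n by (simp add: cot_def c s i_def)
qed

definition sum_sq_sides :: "real^2 \<Rightarrow> real^2 \<Rightarrow> real^2 \<Rightarrow> real" where
  "sum_sq_sides P Q R = (dist Q R)\<^sup>2 + (dist R P)\<^sup>2 + (dist P Q)\<^sup>2"

text \<open>The two inner products at the ends of a side add up to the square of this side; hence the three
  inner products at the vertices add up to half of the sum of the squared sides.\<close>

lemma sum_sq_sides_conv_cot:
  assumes "orientation P Q R \<noteq> 0"
  shows "sum_sq_sides P Q R = 
    2 * \<bar>orientation P Q R\<bar> * (cot (angle R P Q) + cot (angle P Q R) + cot (angle Q R P))"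
proof -
  have o: "orientation R P Q = orientation P Q R" "orientation Q R P = orientation P Q R"
    by (metis orientation_rotate)+
  have "sum_sq_sides P Q R = 
    2 * ((R - P) \<bullet> (Q - P) + (P - Q) \<bullet> (R - Q) + (Q - R) \<bullet> (P - R))"
    unfolding sum_sq_sides_def dist_sq_coords inner_coords
    by (simp add: power2_eq_square algebra_simps)
  then show ?thesis
    using assms by (simp add: cot_angle o field_simps)
qed

lemma sum_sq_sides_similar:
  assumes "orientation P Q R \<noteq> 0" "orientation P' Q' R' \<noteq> 0" "similar_triangles P Q R P' Q' R'"
  shows "sum_sq_sides P Q R * \<bar>orientation P' Q' R'\<bar> = sum_sq_sides P' Q' R' * \<bar>orientation P Q R\<bar>"
  using assms(3)
  unfolding sum_sq_sides_conv_cot[OF assms(1)] sum_sq_sides_conv_cot[OF assms(2)] similar_triangles_def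
  by simp

text \<open>By the cosine rule, the cosine is a homogeneous function of degree zero of the sides.\<close>

lemma angle_sides:
  assumes "k > 0" "dist P Q = k * dist P' Q'" "dist R Q = k * dist R' Q'" "dist R P = k * dist R' P'"
  shows "angle P Q R = angle P' Q' R'"
proof -
  have cosine_rule: "(P - Q) \<bullet> (R - Q) = ((dist P Q)\<^sup>2 + (dist R Q)\<^sup>2 - (dist R P)\<^sup>2) / 2" for P Q R :: "real^2"
    unfolding dist_sq_coords inner_coords by (simp add: power2_eq_square algebra_simps)
  have "(P - Q) \<bullet> (R - Q) = k\<^sup>2 * ((P' - Q') \<bullet> (R' - Q'))"
    unfolding cosine_rule assms(2-4) by (simp add: power_mult_distrib algebra_simps)
  moreover have "norm (P - Q) * norm (R - Q) = k\<^sup>2 * (norm (P' - Q') * norm (R' - Q'))"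
    using assms(2,3) by (simp add: dist_norm power2_eq_square)
  ultimately show ?thesis
    unfolding angle_def using assms(1) by simp
qed

lemma similar_triangles_SSS:
  assumes "k > 0" "dist Q R = k * dist Q' R'" "dist R P = k * dist R' P'" "dist P Q = k * dist P' Q'"
  shows "similar_triangles P Q R P' Q' R'"
  unfolding similar_triangles_def
  using assms by (auto intro!: angle_sides[of k] simp: dist_commute)

section \<open>Pedal triangles\<close>

text \<open>The vector from the foot to \<open>M\<close> is normal to the line, and its signed length is the doubled
  signed area divided by the base. The pedal triangle is thus described by the
  normals of the sides, with signed areas divided by squared sides as coefficients.\<close>

lemma foot_conv_quarter_turn:
  assumes "P \<noteq> Q"
  shows "foot P Q M = M - (orientation P Q M / (dist P Q)\<^sup>2) *\<^sub>R quarter_turn (Q - P)"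
proof -
  define e i f where "e = (dist P Q)\<^sup>2" and "i = (M - P) \<bullet> (Q - P)" and "f = orientation P Q M"
  have e: "e \<noteq> 0" using assms by (simp add: e_def)
  have ee: "(Q - P) \<bullet> (Q - P) = e" unfolding e_def dist_commute[of P Q] by (rule dist_sq_inner[symmetric])
  have "i * (Q$1 - P$1) - f * (Q$2 - P$2) = (M$1 - P$1) * e" "i * (Q$2 - P$2) + f * (Q$1 - P$1) = (M$2 - P$2) * e"
    unfolding e_def i_def f_def dist_sq_coords inner_coords orientation_coords
    by (simp_all add: power2_eq_square algebra_simps)
  then have "M$1 - P$1 = i / e * (Q$1 - P$1) - f / e * (Q$2 - P$2)" "M$2 - P$2 = i / e * (Q$2 - P$2) + f / e * (Q$1 - P$1)"
    using e by (simp_all add: eq_divide_eq flip: diff_divide_distrib add_divide_distrib)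
  then show ?thesis
    unfolding foot_def ee plane_eq_iff e_def[symmetric] i_def[symmetric] f_def[symmetric] by (simp add: right_diff_distrib)
qed

lemma foot_commute: "foot P Q M = foot Q P M"
proof (cases "P = Q")
  case False
  have "orientation Q P M = - orientation P Q M"
    by (simp add: orientation_coords algebra_simps)
  moreover have "quarter_turn (P - Q) = - quarter_turn (Q - P)"
    unfolding plane_eq_iff by simp
  ultimately show ?thesis
    using False False[symmetric] by (simp add: foot_conv_quarter_turn dist_commute)
qed simp

text \<open>The points \<open>A\<close>, \<open>M\<close> and the two feet lie on the circle with diameter \<open>MA\<close>, in which the chord
  between the feet has length \<open>MA * sin A\<close>; and \<open>\<bar>orientation A B C\<bar>\<close> is \<open>CA * AB * sin A\<close>.\<close>

lemma dist_feet:
  assumes "A \<noteq> B" "A \<noteq> C"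
  shows "dist (foot C A M) (foot A B M) * (dist C A * dist A B) = dist M A * \<bar>orientation A B C\<bar>"
proof -
  define x y u v where "x = quarter_turn (C - A)" and "y = quarter_turn (B - A)"
    and "u = orientation A C M" and "v = orientation A B M"
  have n: "x \<bullet> x = (dist C A)\<^sup>2" "y \<bullet> y = (dist A B)\<^sup>2" "x \<bullet> y = (C - A) \<bullet> (B - A)"
    unfolding x_def y_def dist_sq_coords inner_coords by (simp_all add: power2_eq_square algebra_simps)
  have p: "dist C A \<noteq> 0" "dist A B \<noteq> 0" using assms by auto
  have "(dist (foot C A M) (foot A B M))\<^sup>2 = 
     ((v / (dist A B)\<^sup>2) *\<^sub>R y - (u / (dist C A)\<^sup>2) *\<^sub>R x) \<bullet> ((v / (dist A B)\<^sup>2) *\<^sub>R y - (u / (dist C A)\<^sup>2) *\<^sub>R x)"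
    unfolding dist_sq_inner[of "foot _ _ _"] foot_commute[of C A]
    using assms by (simp add: foot_conv_quarter_turn x_def y_def u_def v_def dist_commute)
  also have "\<dots> = v\<^sup>2 / (dist A B)\<^sup>2 + u\<^sup>2 / (dist C A)\<^sup>2 - 2 * u * v * ((C - A) \<bullet> (B - A)) / ((dist A B)\<^sup>2 * (dist C A)\<^sup>2)"
    using p by (simp add: inner_diff_left inner_diff_right inner_commute[of y x] n field_simps power2_eq_square)
  finally have "(dist (foot C A M) (foot A B M))\<^sup>2 * ((dist C A)\<^sup>2 * (dist A B)\<^sup>2) =
      v\<^sup>2 * (dist C A)\<^sup>2 + u\<^sup>2 * (dist A B)\<^sup>2 - 2 * u * v * ((C - A) \<bullet> (B - A))"
    using p by (simp add: field_simps)
  also have "\<dots> = (dist M A)\<^sup>2 * (orientation A B C)\<^sup>2"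
    unfolding u_def v_def orientation_coords dist_sq_coords inner_coords
    by (simp add: power2_eq_square) algebra
  finally have "(dist (foot C A M) (foot A B M) * (dist C A * dist A B))\<^sup>2 = (dist M A * \<bar>orientation A B C\<bar>)\<^sup>2"
    by (simp add: power_mult_distrib)
  then show ?thesis by (simp add: power2_eq_iff_nonneg)
qed

text \<open>The coordinates are quotients of signed areas, by Cramer's rule.\<close>

lemma barycentric_exists:
  assumes "orientation A B C \<noteq> 0"
  obtains x y z where "x + y + z = 1" "M = x *\<^sub>R A + y *\<^sub>R B + z *\<^sub>R C"
proof -
  define D where "D = orientation A B C"
  define x y z where "x = orientation B C M / D" and "y = orientation C A M / D" and "z = orientation A B M / D"
  have D: "D \<noteq> 0" using assms by (simp add: D_def)
  have "x + y + z = 1" unfolding x_def y_def z_def using D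
    by (simp add: add_divide_distrib[symmetric]) (simp add: D_def orientation_coords algebra_simps)
  moreover have "D *\<^sub>R M = orientation B C M *\<^sub>R A + orientation C A M *\<^sub>R B + orientation A B M *\<^sub>R C"
    unfolding plane_eq_iff by (simp add: D_def orientation_coords algebra_simps)
  then have "(1 / D) *\<^sub>R (D *\<^sub>R M) = x *\<^sub>R A + y *\<^sub>R B + z *\<^sub>R C"
    by (simp add: scaleR_add_right x_def y_def z_def)
  then have "M = x *\<^sub>R A + y *\<^sub>R B + z *\<^sub>R C" using D by simp
  ultimately show ?thesis by (rule that)
qed

lemma orientation_barycentric:
  assumes "x + y + z = 1" "M = x *\<^sub>R A + y *\<^sub>R B + z *\<^sub>R C"
  shows "orientation B C M = x * orientation A B C" "orientation C A M = y * orientation A B C"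
    "orientation A B M = z * orientation A B C"
proof -
  have x: "x = 1 - y - z" using assms(1) by simp
  show "orientation B C M = x * orientation A B C" "orientation C A M = y * orientation A B C"
    "orientation A B M = z * orientation A B C"
    by (simp_all add: assms(2) x orientation_coords algebra_simps)
qed

text \<open>Split the pedal triangle at \<open>M\<close> into three triangles. Each of them is spanned by two normals of
  sides of \<open>ABC\<close>, so that its signed area is a multiple of \<open>orientation A B C\<close>.\<close>

lemma orientation_feet:
  assumes "orientation A B C \<noteq> 0" "x + y + z = 1" "M = x *\<^sub>R A + y *\<^sub>R B + z *\<^sub>R C"
  shows "orientation (foot B C M) (foot C A M) (foot A B M) * ((dist B C)\<^sup>2 * (dist C A)\<^sup>2 * (dist A B)\<^sup>2) =
    (orientation A B C)^3 * (y * z * (dist B C)\<^sup>2 + z * x * (dist C A)\<^sup>2 + x * y * (dist A B)\<^sup>2)"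
proof -
  define D where "D = orientation A B C"
  note d = orientation_distinct[OF assms(1)]
  have p: "dist B C \<noteq> 0" "dist C A \<noteq> 0" "dist A B \<noteq> 0" using d by auto
  have gen: "orientation (M - p *\<^sub>R quarter_turn (C - B)) (M - q *\<^sub>R quarter_turn (A - C)) (M - r *\<^sub>R quarter_turn (B - A)) = 
     D * (q * r + r * p + p * q)" for p q r
    unfolding D_def by (simp add: orientation_coords algebra_simps)
  have "orientation (foot B C M) (foot C A M) (foot A B M) = 
     D * (y * D / (dist C A)\<^sup>2 * (z * D / (dist A B)\<^sup>2) + z * D / (dist A B)\<^sup>2 * (x * D / (dist B C)\<^sup>2) + x * D / (dist B C)\<^sup>2 * (y * D / (dist C A)\<^sup>2))"
    using d by (simp add: foot_conv_quarter_turn orientation_barycentric[OF assms(2,3)] gen D_def[symmetric])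
  then show ?thesis unfolding D_def[symmetric] using p
    by (simp add: field_simps power3_eq_cube power2_eq_square)
qed

text \<open>The right-hand side is minus the power of \<open>M\<close> with respect to the circumcircle. With the
  circumcenter as the origin the vertices have equal norms, so the inner product of two of them
  is determined by the side between them.\<close>

lemma power_circumcircle:
  assumes "is_circumcenter A B C Z" "x + y + z = 1" "M = x *\<^sub>R A + y *\<^sub>R B + z *\<^sub>R C"
  shows "y * z * (dist B C)\<^sup>2 + z * x * (dist C A)\<^sup>2 + x * y * (dist A B)\<^sup>2 = (dist Z A)\<^sup>2 - (dist Z M)\<^sup>2"
proof -
  define p q r where "p = A - Z" and "q = B - Z" and "r = C - Z"
  define \<rho> where "\<rho> = (dist Z A)\<^sup>2"
  have n: "p \<bullet> p = \<rho>" "q \<bullet> q = \<rho>" "r \<bullet> r = \<rho>"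
    using assms(1) unfolding is_circumcenter_def \<rho>_def p_def q_def r_def dist_sq_inner[symmetric]
    by (auto simp: dist_commute)
  have s: "(dist B C)\<^sup>2 = 2 * \<rho> - 2 * (q \<bullet> r)" "(dist C A)\<^sup>2 = 2 * \<rho> - 2 * (r \<bullet> p)" "(dist A B)\<^sup>2 = 2 * \<rho> - 2 * (p \<bullet> q)"
  proof -
    have e: "B - C = q - r" "C - A = r - p" "A - B = p - q" by (simp_all add: p_def q_def r_def)
    show "(dist B C)\<^sup>2 = 2 * \<rho> - 2 * (q \<bullet> r)" "(dist C A)\<^sup>2 = 2 * \<rho> - 2 * (r \<bullet> p)" "(dist A B)\<^sup>2 = 2 * \<rho> - 2 * (p \<bullet> q)"
      unfolding dist_sq_inner e by (simp_all add: inner_diff_left inner_diff_right n inner_commute)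
  qed
  have "M - Z = x *\<^sub>R p + y *\<^sub>R q + z *\<^sub>R r - (1 - (x + y + z)) *\<^sub>R Z"
    by (simp add: assms(3) p_def q_def r_def algebra_simps)
  then have m: "M - Z = x *\<^sub>R p + y *\<^sub>R q + z *\<^sub>R r" using assms(2) by simp
  have "(dist Z M)\<^sup>2 = (x\<^sup>2 + y\<^sup>2 + z\<^sup>2) * \<rho> + 2 * (y * z * (q \<bullet> r) + z * x * (r \<bullet> p) + x * y * (p \<bullet> q))"
    unfolding dist_commute[of Z] dist_sq_inner m
    by (simp add: inner_add_left inner_add_right n inner_commute power2_eq_square algebra_simps)
  \<comment> \<open>Making \<open>\<rho>\<close> homogeneous of degree two in \<open>x, y, z\<close> lets the square terms cancel.\<close>
  moreover have "\<rho> = (x + y + z)\<^sup>2 * \<rho>" using assms(2) by simp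
  ultimately show ?thesis unfolding s \<rho>_def[symmetric] by (simp add: power2_eq_square algebra_simps)
qed

section \<open>The Lemoine point\<close>

text \<open>The reflection in the bisector exchanges the unit vectors \<open>u\<close> and \<open>v\<close> along the sides \<open>AB\<close> and \<open>AC\<close>.
  Hence it takes the direction \<open>c *\<^sub>R u + b *\<^sub>R v\<close> of the median to \<open>b *\<^sub>R u + c *\<^sub>R v\<close>, which is
  proportional to \<open>b\<^sup>2 *\<^sub>R (B - A) + c\<^sup>2 *\<^sub>R (C - A)\<close>.\<close>

lemma symmedian_subset:
  assumes "X \<in> symmedian A B C" "orientation A B C \<noteq> 0"
  shows "\<exists>k. X - A = k *\<^sub>R ((dist C A)\<^sup>2 *\<^sub>R (B - A) + (dist A B)\<^sup>2 *\<^sub>R (C - A))"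
proof -
  define b c where "b = dist C A" and "c = dist A B"
  define u v where "u = sgn (B - A)" and "v = sgn (C - A)"
  note d = orientation_distinct[OF assms(2)]
  have bc: "b > 0" "c > 0" using d by (auto simp: b_def c_def)
  have uv: "B - A = c *\<^sub>R u" "C - A = b *\<^sub>R v"
    unfolding u_def v_def b_def c_def sgn_div_norm dist_norm using d by (simp_all add: norm_minus_commute)
  have one: "u \<bullet> u = 1" "v \<bullet> v = 1"
    using d by (simp_all add: u_def v_def dot_square_norm norm_sgn)
  have "u + v \<noteq> 0"
  proof
    assume "u + v = 0"
    then have "v = - u" by (simp add: add_eq_0_iff)
    then have "B$1 - A$1 = c * u$1" "B$2 - A$2 = c * u$2" "C$1 - A$1 = - b * u$1" "C$2 - A$2 = - b * u$2"
      using uv unfolding plane_eq_iff by auto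
    then have "orientation A B C = 0" unfolding orientation_coords by simp
    with assms(2) show False by simp
  qed
  then have nz: "(u + v) \<bullet> (u + v) \<noteq> 0" by simp
  obtain Y where Y: "Y \<in> affine hull {A, midpoint B C}" "X = reflect A (angle_bisector_point A B C) Y"
    using assms(1) unfolding symmedian_def by auto
  then obtain t s where ts: "t + s = 1" "Y = t *\<^sub>R A + s *\<^sub>R midpoint B C"
    unfolding affine_hull_2 by auto
  have t: "t = 1 - s" using ts(1) by simp
  have "Y - A = (s/2) *\<^sub>R ((B - A) + (C - A))"
    unfolding ts(2) t plane_eq_iff by (simp add: midpoint_def field_simps)
  then have YA: "Y - A = (s/2) *\<^sub>R (c *\<^sub>R u + b *\<^sub>R v)" unfolding uv .
  \<comment> \<open>The foot of \<open>Y\<close> on the bisector is \<open>A + h *\<^sub>R (u + v)\<close>.\<close>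
  define h where "h = ((Y - A) \<bullet> (u + v)) / ((u + v) \<bullet> (u + v))"
  have h: "h = s/2 * ((b + c)/2)"
  proof -
    have "(u + v) \<bullet> (u + v) = 2 * (1 + u \<bullet> v)" by (simp add: inner_add_left inner_add_right one inner_commute)
    moreover have "(Y - A) \<bullet> (u + v) = s/2 * ((b + c)/2) * (2 * (1 + u \<bullet> v))"
      unfolding YA by (simp add: inner_add_left inner_add_right one inner_commute field_simps)
    ultimately show ?thesis using nz by (metis h_def nonzero_mult_div_cancel_right)
  qed
  have "angle_bisector_point A B C - A = u + v" by (simp add: angle_bisector_point_def u_def v_def)
  then have "X - A = 2 *\<^sub>R h *\<^sub>R (u + v) - (Y - A)"
    unfolding Y(2) reflect_def foot_def h_def by (simp add: algebra_simps scaleR_2)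
  also have "\<dots> = (s/2) *\<^sub>R (b *\<^sub>R u + c *\<^sub>R v)"
    unfolding YA h plane_eq_iff by (simp add: field_simps)
  also have "\<dots> = (s/2/(b*c)) *\<^sub>R (b\<^sup>2 *\<^sub>R (B - A) + c\<^sup>2 *\<^sub>R (C - A))"
    unfolding uv plane_eq_iff using bc by (simp add: field_simps power2_eq_square)
  finally show ?thesis unfolding b_def c_def by blast
qed

text \<open>Two symmedians already determine the point: each gives its offset from a vertex up to a factor, and
  the two offsets differ by \<open>B - A\<close>. Normal to \<open>AB\<close> this shows that the factors are equal, and along \<open>AB\<close> it
  gives their value.\<close>

lemma lemoine_barycentric:
  assumes "is_lemoine_point A B C L" "orientation A B C \<noteq> 0"
  shows "sum_sq_sides A B C *\<^sub>R L = (dist B C)\<^sup>2 *\<^sub>R A + (dist C A)\<^sup>2 *\<^sub>R B + (dist A B)\<^sup>2 *\<^sub>R C"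
proof -
  define a b c where "a = (dist B C)\<^sup>2" and "b = (dist C A)\<^sup>2" and "c = (dist A B)\<^sup>2"
  have c0: "c \<noteq> 0" using orientation_distinct[OF assms(2)] by (simp add: c_def)
  obtain k where k: "L - A = k *\<^sub>R (b *\<^sub>R (B - A) + c *\<^sub>R (C - A))"
    using symmedian_subset[of L A B C] assms unfolding is_lemoine_point_def b_def c_def by auto
  obtain m where m: "L - B = m *\<^sub>R (c *\<^sub>R (C - B) + a *\<^sub>R (A - B))"
    using symmedian_subset[of L B C A] assms(1) assms(2)[unfolded orientation_rotate[of A B C]]
    unfolding is_lemoine_point_def a_def c_def by auto
  define f where "f = orientation A B C"
  have "orientation A B L = k * c * f" 
  proof -
    have "L$1 - A$1 = k * (b * (B$1 - A$1) + c * (C$1 - A$1))" "L$2 - A$2 = k * (b * (B$2 - A$2) + c * (C$2 - A$2))"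
      using arg_cong[OF k, of "\<lambda>v. v$1"] arg_cong[OF k, of "\<lambda>v. v$2"] by simp_all
    then show ?thesis unfolding f_def orientation_coords by (simp only:) (simp add: algebra_simps)
  qed
  moreover have "orientation A B L = m * c * f"
  proof -
    have "L$1 - B$1 = m * (c * (C$1 - B$1) + a * (A$1 - B$1))" "L$2 - B$2 = m * (c * (C$2 - B$2) + a * (A$2 - B$2))"
      using arg_cong[OF m, of "\<lambda>v. v$1"] arg_cong[OF m, of "\<lambda>v. v$2"] by simp_all
    then have "orientation B L A = m * c * f"
      unfolding f_def orientation_coords by (simp only:) (simp add: algebra_simps)
    then show ?thesis by (simp only: orientation_rotate[of A B L])
  qed
  ultimately have km: "m = k" using c0 assms(2) by (simp add: f_def)
  have "(B - A) = (L - A) - (L - B)" by simp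
  then have e: "B - A = k *\<^sub>R (b *\<^sub>R (B - A) + c *\<^sub>R (C - A)) - k *\<^sub>R (c *\<^sub>R (C - B) + a *\<^sub>R (A - B))"
    unfolding k m km .
  have "(1 - k * (a + b + c)) *\<^sub>R (B - A) = 0"
    using e unfolding plane_eq_iff by (simp add: algebra_simps)
  then have k1: "(a + b + c) * k = 1" using orientation_distinct[OF assms(2)] by (simp add: mult.commute)
  have "(a + b + c) *\<^sub>R (L - A) = b *\<^sub>R (B - A) + c *\<^sub>R (C - A)"
    unfolding k using k1 by simp
  then show ?thesis unfolding sum_sq_sides_def a_def[symmetric] b_def[symmetric] c_def[symmetric]
    by (simp add: algebra_simps)
qed

section \<open>The Brocard circle in terms of pedal triangles\<close>

text \<open>Thales' theorem; it includes the case where the circle is a single point.\<close>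

lemma brocard_circle_iff_inner: "M \<in> brocard_circle Z L \<longleftrightarrow> (M - Z) \<bullet> (M - L) = 0"
proof -
  have "M \<in> brocard_circle Z L \<longleftrightarrow> (dist (midpoint Z L) M)\<^sup>2 = (dist Z L / 2)\<^sup>2"
    unfolding brocard_circle_def by (simp add: power2_eq_iff_nonneg)
  also have "\<dots> \<longleftrightarrow> (dist (midpoint Z L) M)\<^sup>2 - (dist Z L)\<^sup>2 / 4 = 0" by (simp add: power_divide)
  also have "(dist (midpoint Z L) M)\<^sup>2 - (dist Z L)\<^sup>2 / 4 = (M - Z) \<bullet> (M - L)"
    unfolding dist_sq_coords inner_coords by (simp add: midpoint_def field_simps power2_eq_square)
  finally show ?thesis .
qed

text \<open>For \<open>D\<^sub>1 \<noteq> 0\<close> the equation says that the pedal triangle and \<open>ABC\<close> have the same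
  quotient of the sum of the squared sides by the signed area, hence the same Brocard angle.\<close>

lemma brocard_circle_iff_pedal:
  assumes D: "orientation A B C \<noteq> 0" and Z: "is_circumcenter A B C Z" and L: "is_lemoine_point A B C L"
  shows "M \<in> brocard_circle Z L \<longleftrightarrow>
    sum_sq_sides (foot B C M) (foot C A M) (foot A B M) * orientation A B C =
    sum_sq_sides A B C * orientation (foot B C M) (foot C A M) (foot A B M)"
proof -
  define a b c where "a = (dist B C)\<^sup>2" and "b = (dist C A)\<^sup>2" and "c = (dist A B)\<^sup>2"
  define D' where "D' = orientation A B C"
  define p where "p = (dist Z A)\<^sup>2 - (dist Z M)\<^sup>2"
  define S where "S = sum_sq_sides A B C"
  define S1 where "S1 = sum_sq_sides (foot B C M) (foot C A M) (foot A B M)"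
  define D1 where "D1 = orientation (foot B C M) (foot C A M) (foot A B M)"
  note d = orientation_distinct[OF D]
  have abc: "a > 0" "b > 0" "c > 0" using d by (auto simp: a_def b_def c_def)
  have S: "S = a + b + c" by (simp add: S_def sum_sq_sides_def a_def b_def c_def)
  have side_gen: "(dist (foot R P M) (foot P Q M))\<^sup>2 * ((dist R P)\<^sup>2 * (dist P Q)\<^sup>2) = (dist M P)\<^sup>2 * (orientation P Q R)\<^sup>2"
    if "P \<noteq> Q" "P \<noteq> R" for P Q R
    using arg_cong[OF dist_feet[OF that, of M], of "\<lambda>t. t\<^sup>2"] by (simp only: power_mult_distrib power2_abs)
  have side: "(dist (foot C A M) (foot A B M))\<^sup>2 * (b * c) = (dist M A)\<^sup>2 * D'\<^sup>2"
     "(dist (foot A B M) (foot B C M))\<^sup>2 * (c * a) = (dist M B)\<^sup>2 * D'\<^sup>2"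
     "(dist (foot B C M) (foot C A M))\<^sup>2 * (a * b) = (dist M C)\<^sup>2 * D'\<^sup>2"
    unfolding a_def b_def c_def D'_def
    using side_gen[OF d(1) d(3)[symmetric]] side_gen[OF d(2) d(1)[symmetric]] side_gen[OF d(3) d(2)[symmetric]]
    by (simp_all only: orientation_rotate[of C A B] orientation_rotate[of B C A])
  have "S1 * (a * b * c) = (dist (foot C A M) (foot A B M))\<^sup>2 * (b * c) * a +
     (dist (foot A B M) (foot B C M))\<^sup>2 * (c * a) * b + (dist (foot B C M) (foot C A M))\<^sup>2 * (a * b) * c"
    by (simp add: S1_def sum_sq_sides_def algebra_simps)
  then have S1: "S1 * (a * b * c) = D'\<^sup>2 * (a * (dist M A)\<^sup>2 + b * (dist M B)\<^sup>2 + c * (dist M C)\<^sup>2)"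
    unfolding side by (simp add: algebra_simps)
  obtain x y z where xyz: "x + y + z = 1" "M = x *\<^sub>R A + y *\<^sub>R B + z *\<^sub>R C"
    using barycentric_exists[OF D] by metis
  have D1: "D1 * (a * b * c) = D'^3 * p"
    using orientation_feet[OF D xyz] unfolding power_circumcircle[OF Z xyz] D1_def D'_def a_def b_def c_def p_def .
  \<comment> \<open>The cosine rule in the triangle \<open>ZMP\<close>, for \<open>P\<close> on the circumcircle.\<close>
  have polar: "2 * ((M - Z) \<bullet> (M - P)) = (dist M P)\<^sup>2 - p" if "dist Z P = dist Z A" for P
    unfolding p_def that[symmetric] dist_sq_coords inner_coords by (simp add: power2_eq_square algebra_simps)
  have "S *\<^sub>R (M - L) = a *\<^sub>R (M - A) + b *\<^sub>R (M - B) + c *\<^sub>R (M - C)"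
    using lemoine_barycentric[OF L D] unfolding S_def[symmetric] a_def[symmetric] b_def[symmetric] c_def[symmetric]
    by (simp add: scaleR_diff_right S scaleR_add_left)
  then have "2 * ((M - Z) \<bullet> (S *\<^sub>R (M - L))) = 
     a * (2 * ((M - Z) \<bullet> (M - A))) + b * (2 * ((M - Z) \<bullet> (M - B))) + c * (2 * ((M - Z) \<bullet> (M - C)))"
    by (simp add: inner_add_right)
  also have "\<dots> = a * (dist M A)\<^sup>2 + b * (dist M B)\<^sup>2 + c * (dist M C)\<^sup>2 - S * p"
  proof -
    have "dist Z A = dist Z A" "dist Z B = dist Z A" "dist Z C = dist Z A"
      using Z by (auto simp: is_circumcenter_def)
    then show ?thesis by (simp only: polar S) (simp add: algebra_simps)
  qed
  finally have main: "2 * S * ((M - Z) \<bullet> (M - L)) = a * (dist M A)\<^sup>2 + b * (dist M B)\<^sup>2 + c * (dist M C)\<^sup>2 - S * p"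
    by simp
  have "(S1 * D' - S * D1) * (a * b * c) = D' * (S1 * (a * b * c)) - S * (D1 * (a * b * c))"
    by (simp add: algebra_simps)
  also have "\<dots> = D'^3 * (2 * S * ((M - Z) \<bullet> (M - L)))"
    unfolding main S1 D1 by (simp add: power3_eq_cube power2_eq_square algebra_simps)
  finally have "S1 * D' - S * D1 = 0 \<longleftrightarrow> (M - Z) \<bullet> (M - L) = 0"
    using abc D unfolding D'_def[symmetric] S by (metis add_pos_pos mult_eq_0_iff power_eq_0_iff less_irrefl zero_neq_numeral)
  then show ?thesis unfolding brocard_circle_iff_inner S_def S1_def D1_def D'_def by auto
qed

text \<open>Only the multiset of the angles of the pedal triangle matters, because the sum of their cotangents is symmetric;
  this treats the six correspondences of the vertices alike.\<close>

lemma positive_pedal_similar_imp_brocard_circle: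
  assumes D: "orientation A B C \<noteq> 0" and Z: "is_circumcenter A B C Z" and L: "is_lemoine_point A B C L"
    and M: "positive_pedal_similar A B C M P Q R" and perm: "{#P, Q, R#} = {#A, B, C#}"
  shows "M \<in> brocard_circle Z L"
proof -
  have P: "(P, Q, R) \<in> {(A, B, C), (B, C, A), (C, A, B), (A, C, B), (C, B, A), (B, A, C)}"
    using perm by (auto simp: add_eq_conv_ex)
  have S: "sum_sq_sides P Q R = sum_sq_sides A B C"
    using P by (auto simp: sum_sq_sides_def dist_commute)
  have o: "\<bar>orientation P Q R\<bar> = \<bar>orientation A B C\<bar>"
  proof -
    have "orientation P Q R = orientation A B C \<or> orientation P Q R = - orientation A B C"
      using P by (auto simp: orientation_coords algebra_simps)
    then show ?thesis by auto
  qed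
  let ?f = "orientation A B C" and ?g = "orientation (foot B C M) (foot C A M) (foot A B M)"
  let ?S = "sum_sq_sides (foot B C M) (foot C A M) (foot A B M)"
  have pos: "?g * ?f > 0" and sim: "similar_triangles (foot B C M) (foot C A M) (foot A B M) P Q R"
    using M by (simp_all add: positive_pedal_similar_def same_orientation_def Let_def)
  have "?S * \<bar>?f\<bar> = sum_sq_sides A B C * \<bar>?g\<bar>"
    using sum_sq_sides_similar[OF _ _ sim] pos D o S by force
  then have "?S * ?f = sum_sq_sides A B C * ?g"
    using pos by (auto simp: abs_if zero_less_mult_iff)
  then show ?thesis using brocard_circle_iff_pedal[OF D Z L] by simp
qed

section \<open>The pedal triangles of the circumcenter and the Brocard points\<close>

lemma circumcenter_pedal:
  assumes D: "orientation A B C \<noteq> 0" and Z: "is_circumcenter A B C Z"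
  shows "positive_pedal_similar A B C Z A B C"
proof -
  have foot: "foot P Q Z = midpoint P Q" if "dist Z P = dist Z Q" "P \<noteq> Q" for P Q
  proof -
    define i n where "i = (Z - P) \<bullet> (Q - P)" and "n = (Q - P) \<bullet> (Q - P)"
    have "2 * i - n = (dist Z P)\<^sup>2 - (dist Z Q)\<^sup>2"
      unfolding i_def n_def dist_sq_coords inner_coords by (simp add: power2_eq_square algebra_simps)
    moreover have "n \<noteq> 0" using that(2) by (simp add: n_def)
    ultimately have "i / n = 1/2"
      using that(1) by (simp add: field_simps)
    then show ?thesis unfolding foot_def i_def[symmetric] n_def[symmetric] by (simp add: midpoint_def plane_eq_iff field_simps)
  qed
  note d = orientation_distinct[OF D]
  have "similar_triangles (midpoint B C) (midpoint C A) (midpoint A B) A B C"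
  proof (rule similar_triangles_SSS[of "1/2"])
    have mid: "dist (midpoint P Q) (midpoint Q R) = 1/2 * dist R P" for P Q R :: "real^2"
    proof -
      have "midpoint P Q - midpoint Q R = (1/2) *\<^sub>R (P - R)"
        unfolding plane_eq_iff by (simp add: midpoint_def field_simps)
      then show ?thesis by (simp add: dist_norm norm_minus_commute)
    qed
    show "dist (midpoint C A) (midpoint A B) = 1/2 * dist B C"
      "dist (midpoint A B) (midpoint B C) = 1/2 * dist C A"
      "dist (midpoint B C) (midpoint C A) = 1/2 * dist A B" by (rule mid)+
  qed simp
  moreover have "orientation (midpoint B C) (midpoint C A) (midpoint A B) = orientation A B C / 4"
    unfolding orientation_coords by (simp add: midpoint_def field_simps)
  then have "same_orientation (midpoint B C) (midpoint C A) (midpoint A B) A B C"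
    unfolding same_orientation_def by (simp only:) (use D in \<open>auto simp: zero_less_mult_iff\<close>)
  ultimately show ?thesis
    using Z d unfolding positive_pedal_similar_def is_circumcenter_def Let_def by (simp add: foot)
qed

text \<open>Let \<open>\<kappa>\<close> be the cotangent of the three equal angles, and \<open>d\<close> the absolute value of the doubled area.
  Each of the three angle conditions expresses an inner product as \<open>\<kappa> * d\<close> times a coordinate. Adding them
  gives \<open>\<kappa> * d = (a + b + c) / 2\<close>, where \<open>a, b, c\<close> are the squared sides; with this value, the conditions
  at \<open>A\<close> and \<open>B\<close> reduce to the two proportions.\<close>

lemma first_brocard_barycentric:
  assumes D: "orientation A B C \<noteq> 0" and W: "W = x *\<^sub>R A + y *\<^sub>R B + z *\<^sub>R C"
    and pos: "x > 0" "y > 0" "z > 0" "x + y + z = 1"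
    and ang: "angle W A B = angle W B C" "angle W B C = angle W C A"
  shows "y * (dist A B)\<^sup>2 = z * (dist B C)\<^sup>2" "z * (dist B C)\<^sup>2 = x * (dist C A)\<^sup>2"
proof -
  define a b c where "a = (dist B C)\<^sup>2" and "b = (dist C A)\<^sup>2" and "c = (dist A B)\<^sup>2"
  define \<kappa> where "\<kappa> = cot (angle W A B)"
  define d where "d = \<bar>orientation A B C\<bar>"
  have d0: "d > 0" using D by (simp add: d_def)
  have o: "orientation W B C = x * orientation A B C" "orientation W C A = y * orientation A B C"
    "orientation W A B = z * orientation A B C"
    using orientation_barycentric[OF pos(4) W]
    by (simp_all only: orientation_rotate[of W B C] orientation_rotate[of W C A] orientation_rotate[of W A B])
  have inner: "(U - Q) \<bullet> (R - Q) = cot (angle U Q R) * (m * d)"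
    if "orientation U Q R = m * orientation A B C" "m > 0" for U Q R m
    using cot_angle[of U Q R] that D by (simp add: abs_mult d_def)
  have inn: "(W - A) \<bullet> (B - A) = \<kappa> * (z * d)" "(W - B) \<bullet> (C - B) = \<kappa> * (x * d)" "(W - C) \<bullet> (A - C) = \<kappa> * (y * d)"
    using inner[OF o(3) pos(3)] inner[OF o(1) pos(1)] inner[OF o(2) pos(2)] ang by (simp_all add: \<kappa>_def)
  have "a + b + c = 2 * ((W - A) \<bullet> (B - A) + (W - B) \<bullet> (C - B) + (W - C) \<bullet> (A - C))"
    unfolding a_def b_def c_def dist_sq_coords inner_coords by (simp add: power2_eq_square algebra_simps)
  also have "\<dots> = 2 * \<kappa> * d * (x + y + z)" unfolding inn by (simp add: algebra_simps)
  finally have K: "\<kappa> * d = (a + b + c) / 2" using pos(4) by simp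
  have x: "x = 1 - y - z" using pos(4) by simp
  have 1: "(W - A) \<bullet> (B - A) = y * c + z * ((b + c - a) / 2)"
    unfolding W x a_def b_def c_def dist_sq_coords inner_coords by (simp add: field_simps power2_eq_square)
  have y: "y = 1 - x - z" using pos(4) by simp
  have 2: "(W - B) \<bullet> (C - B) = z * a + x * ((c + a - b) / 2)"
    unfolding W y a_def b_def c_def dist_sq_coords inner_coords by (simp add: field_simps power2_eq_square)
  have "y * c + z * ((b + c - a) / 2) = z * (\<kappa> * d)" using 1 inn(1) by (simp only: ac_simps)
  then show "y * (dist A B)\<^sup>2 = z * (dist B C)\<^sup>2" unfolding K by (simp add: a_def b_def c_def field_simps)
  have "z * a + x * ((c + a - b) / 2) = x * (\<kappa> * d)" using 2 inn(2) by (simp only: ac_simps)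
  then show "z * (dist B C)\<^sup>2 = x * (dist C A)\<^sup>2" unfolding K by (simp add: a_def b_def c_def field_simps)
qed


text \<open>The coordinates give \<open>MA : MB : MC = b\<^sup>2 c : c\<^sup>2 a : a\<^sup>2 b\<close>, and so the sides \<open>B\<^sub>1C\<^sub>1, C\<^sub>1A\<^sub>1, A\<^sub>1B\<^sub>1\<close> of
  the pedal triangle are proportional to \<open>b, c, a\<close>. The orientation is positive because the
  barycentric coordinates of an interior point are positive.\<close>

lemma first_brocard_pedal:
  assumes nc: "\<not> collinear {A, B, C}" and W: "is_first_brocard_point A B C W"
  shows "positive_pedal_similar A B C W B C A"
proof -
  define a b c where "a = dist B C" and "b = dist C A" and "c = dist A B"
  have D: "orientation A B C \<noteq> 0" using nc by (rule orientation_nonzero)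
  note d = orientation_distinct[OF D]
  have abc: "a > 0" "b > 0" "c > 0" using d by (auto simp: a_def b_def c_def)
  obtain x y z where pos: "0 < x" "0 < y" "0 < z" "x + y + z = 1" and bary: "W = x *\<^sub>R A + y *\<^sub>R B + z *\<^sub>R C"
    using W unfolding is_first_brocard_point_def interior_convex_hull_3_minimal[OF nc, simplified] by auto
  have ratio: "y * c\<^sup>2 = z * a\<^sup>2" "z * a\<^sup>2 = x * b\<^sup>2"
    using first_brocard_barycentric[OF D bary pos] W unfolding is_first_brocard_point_def a_def b_def c_def by auto
  \<comment> \<open>\<open>t\<close> is the common factor of the coordinates; their sum being 1, it is the inverse of
    \<open>a\<^sup>2 * b\<^sup>2 + b\<^sup>2 * c\<^sup>2 + c\<^sup>2 * a\<^sup>2\<close>.\<close>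
  define t where "t = x / (c\<^sup>2 * a\<^sup>2)"
  have t: "t > 0" using pos abc by (simp add: t_def)
  have xyz: "x = t * c\<^sup>2 * a\<^sup>2" "y = t * a\<^sup>2 * b\<^sup>2" "z = t * b\<^sup>2 * c\<^sup>2"
    using ratio abc by (simp_all add: t_def field_simps)
  let ?T = "a\<^sup>2 * b\<^sup>2 + b\<^sup>2 * c\<^sup>2 + c\<^sup>2 * a\<^sup>2"
  have tT: "t * ?T = 1" using pos(4) by (simp add: xyz algebra_simps)
  \<comment> \<open>The inner product of \<open>Q - P\<close> and \<open>R - P\<close> is written by the cosine rule.\<close>
  have vertex: "(dist W P)\<^sup>2 = q\<^sup>2 * (dist P Q)\<^sup>2 + r\<^sup>2 * (dist R P)\<^sup>2 + q * r * ((dist P Q)\<^sup>2 + (dist R P)\<^sup>2 - (dist Q R)\<^sup>2)"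
    if "p + q + r = 1" "W = p *\<^sub>R P + q *\<^sub>R Q + r *\<^sub>R R" for P Q R p q r
  proof -
    have p: "p = 1 - q - r" using that by simp
    show ?thesis unfolding that(2) p dist_sq_coords by (simp add: power2_eq_square algebra_simps)
  qed
  \<comment> \<open>Keeping \<open>t * ?T\<close> unevaluated makes the next three equations polynomial identities.\<close>
  have "(dist W A)\<^sup>2 = (t * ?T) * (t * b^4 * c\<^sup>2)"
    unfolding vertex[OF pos(4) bary] a_def[symmetric] b_def[symmetric] c_def[symmetric] xyz by (simp add: power2_eq_square power4_eq_xxxx algebra_simps)
  moreover have "(dist W B)\<^sup>2 = (t * ?T) * (t * c^4 * a\<^sup>2)"
  proof -
    have "y + z + x = 1" "W = y *\<^sub>R B + z *\<^sub>R C + x *\<^sub>R A"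
      using pos(4) bary by simp_all
    from vertex[OF this] show ?thesis
      unfolding a_def[symmetric] b_def[symmetric] c_def[symmetric] xyz 
    by (simp add: power2_eq_square power4_eq_xxxx algebra_simps)
  qed
  moreover have "(dist W C)\<^sup>2 = (t * ?T) * (t * a^4 * b\<^sup>2)"
  proof -
    have "z + x + y = 1" "W = z *\<^sub>R C + x *\<^sub>R A + y *\<^sub>R B"
      using pos(4) bary by simp_all
    from vertex[OF this] show ?thesis
      unfolding a_def[symmetric] b_def[symmetric] c_def[symmetric] xyz 
    by (simp add: power2_eq_square power4_eq_xxxx algebra_simps)
  qed
  ultimately have sq: "(dist W A)\<^sup>2 = (sqrt t * b\<^sup>2 * c)\<^sup>2" "(dist W B)\<^sup>2 = (sqrt t * c\<^sup>2 * a)\<^sup>2" "(dist W C)\<^sup>2 = (sqrt t * a\<^sup>2 * b)\<^sup>2"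
    unfolding tT using t by (simp_all add: power_mult_distrib flip: power_mult)
  have dist: "dist W A = sqrt t * b\<^sup>2 * c" "dist W B = sqrt t * c\<^sup>2 * a" "dist W C = sqrt t * a\<^sup>2 * b"
    using sq t abc by (simp_all add: power2_eq_iff_nonneg)
  define k where "k = sqrt t * \<bar>orientation A B C\<bar>"
  have "similar_triangles (foot B C W) (foot C A W) (foot A B W) B C A"
  proof (rule similar_triangles_SSS)
    show "k > 0" using t D by (simp add: k_def)
    show "dist (foot C A W) (foot A B W) = k * dist C A"
      using dist_feet[OF d(1) d(3)[symmetric], of W] abc
      unfolding dist a_def[symmetric] b_def[symmetric] c_def[symmetric] k_def by (simp add: field_simps power2_eq_square)
    show "dist (foot A B W) (foot B C W) = k * dist A B"
      using dist_feet[OF d(2) d(1)[symmetric], of W] abc orientation_rotate[of A B C]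
      unfolding dist a_def[symmetric] b_def[symmetric] c_def[symmetric] k_def by (simp add: field_simps power2_eq_square)
    show "dist (foot B C W) (foot C A W) = k * dist B C"
      using dist_feet[OF d(3) d(2)[symmetric], of W] abc orientation_rotate[of C A B]
      unfolding dist a_def[symmetric] b_def[symmetric] c_def[symmetric] k_def by (simp add: field_simps power2_eq_square)
  qed
  moreover have "orientation (foot B C W) (foot C A W) (foot A B W) * orientation A B C > 0"
  proof -
    define f where "f = orientation A B C"
    have "(orientation (foot B C W) (foot C A W) (foot A B W) * f) * (a\<^sup>2 * b\<^sup>2 * c\<^sup>2) = f^4 * (y * z * a\<^sup>2 + z * x * b\<^sup>2 + x * y * c\<^sup>2)"
      using arg_cong[OF orientation_feet[OF D pos(4) bary], of "\<lambda>u. u * f"]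
      unfolding f_def[symmetric] a_def[symmetric] b_def[symmetric] c_def[symmetric]
      by (simp add: power3_eq_cube power4_eq_xxxx algebra_simps)
    also have "\<dots> > 0" using pos abc D unfolding f_def
      by (intro mult_pos_pos add_pos_pos) (simp_all add: zero_less_power_eq)
    finally show ?thesis
      unfolding f_def by (rule zero_less_mult_pos2) (use abc in simp_all)
  qed
  ultimately show ?thesis by (simp add: positive_pedal_similar_def same_orientation_def Let_def)
qed

lemma angle_commute: "angle P Q R = angle R Q P"
  by (simp add: angle_def inner_commute mult.commute)

lemma positive_pedal_similar_swap:
  "positive_pedal_similar A C B M P R Q \<longleftrightarrow> positive_pedal_similar A B C M P Q R"
proof -
  have "same_orientation P R Q P' R' Q' \<longleftrightarrow> same_orientation P Q R P' Q' R'" for P Q R P' Q' R'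
    by (simp add: same_orientation_def orientation_swap[of P R Q] orientation_swap[of P' R' Q'])
  moreover have "similar_triangles P R Q P' R' Q' \<longleftrightarrow> similar_triangles P Q R P' Q' R'" for P Q R P' Q' R'
    unfolding similar_triangles_def angle_commute[of Q P R] angle_commute[of P R Q] angle_commute[of R Q P]
      angle_commute[of Q' P' R'] angle_commute[of P' R' Q'] angle_commute[of R' Q' P'] by blast
  ultimately show ?thesis
    unfolding positive_pedal_similar_def Let_def foot_commute[of C B] foot_commute[of B A] foot_commute[of A C] by simp
qed

text \<open>A second Brocard point of \<open>ABC\<close> is a first Brocard point of \<open>ACB\<close>.\<close>

lemma second_brocard_pedal:
  assumes nc: "\<not> collinear {A, B, C}" and W: "is_second_brocard_point A B C W"
  shows "positive_pedal_similar A B C W C A B"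
proof -
  have "{A, C, B} = {A, B, C}" by auto
  then have "is_first_brocard_point A C B W" "\<not> collinear {A, C, B}"
    using nc W unfolding is_first_brocard_point_def is_second_brocard_point_def by auto
  then show ?thesis
    using first_brocard_pedal[of A C B W] positive_pedal_similar_swap[of A C B W C B A] by blast
qed

theorem theorem2p1:
  fixes A B C Z L \<Omega>1 \<Omega>2 L1 L2 L3 :: "real^2"
  assumes "\<not> collinear {A, B, C}"
    and "is_circumcenter A B C Z"
    and "is_lemoine_point A B C L"
    and "is_first_brocard_point A B C \<Omega>1"
    and "is_second_brocard_point A B C \<Omega>2"
    and "positive_pedal_similar A B C L1 A C B"
    and "positive_pedal_similar A B C L2 C B A"
    and "positive_pedal_similar A B C L3 B A C"
  shows "{Z, \<Omega>1, \<Omega>2, L1, L2, L3} \<subseteq> brocard_circle Z L \<and>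
    positive_pedal_similar A B C Z A B C \<and>
    positive_pedal_similar A B C \<Omega>1 B C A \<and>
    positive_pedal_similar A B C \<Omega>2 C A B"
proof -
  have D: "orientation A B C \<noteq> 0" using assms(1) by (rule orientation_nonzero)
  have pedal: "positive_pedal_similar A B C Z A B C" "positive_pedal_similar A B C \<Omega>1 B C A" 
    "positive_pedal_similar A B C \<Omega>2 C A B"
    using circumcenter_pedal[OF D assms(2)] first_brocard_pedal[OF assms(1,4)] second_brocard_pedal[OF assms(1,5)] .
  have perm: "{#A, B, C#} = {#A, B, C#}" "{#B, C, A#} = {#A, B, C#}" "{#C, A, B#} = {#A, B, C#}"
    "{#A, C, B#} = {#A, B, C#}" "{#C, B, A#} = {#A, B, C#}" "{#B, A, C#} = {#A, B, C#}"
    by (simp_all add: add_mset_commute)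
  note on_circle = positive_pedal_similar_imp_brocard_circle[OF D assms(2,3)]
  have "Z \<in> brocard_circle Z L" "\<Omega>1 \<in> brocard_circle Z L" "\<Omega>2 \<in> brocard_circle Z L"
    "L1 \<in> brocard_circle Z L" "L2 \<in> brocard_circle Z L" "L3 \<in> brocard_circle Z L"
    using on_circle[OF pedal(1) perm(1)] on_circle[OF pedal(2) perm(2)] on_circle[OF pedal(3) perm(3)]
      on_circle[OF assms(6) perm(4)] on_circle[OF assms(7) perm(5)] on_circle[OF assms(8) perm(6)] .
  then show ?thesis using pedal by simp
qed

end
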